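(* Let $F\in\mathcal{H}^d$ be such that there exists $\mathbf{b}\in\mathbb{R}^d_{++}$ with $\mathcal{A}(F)^T\mathbf{b}=\mathbf{b}$. Let $\mathcal{G}\in\{\mathcal{G}(F),\mathcal{G}^-(F)\}$. If for every $(\nu,l_\nu)\in\mathcal{I}$ and every $(j_1,\ldots,j_d)\in[n_1]\times\cdots\times[n_d]$ there exists $i_\nu\in[d]$ such that there is a path from $(i_\nu,j_{i_\nu})$ to $(\nu,l_\nu)$ in $\mathcal{G}$, then $F$ has an eigenvector in $\mathcal{S}_{++}$.
   Context: $[n]=\{1,\ldots,n\}$. Fix positive integers $d,n_1,\ldots,n_d$. Let $\mathcal{K}_+=\mathbb{R}^{n_1}_+\times\cdots\times\mathbb{R}^{n_d}_+$ (nonnegative entries), $\mathcal{K}_{++}=\mathbb{R}^{n_1}_{++}\times\cdots\times\mathbb{R}^{n_d}_{++}$ (positive entries), $\mathcal{I}=\bigcup_{k=1}^d(\{k\}\times[n_k])$. Write $\mathbf{x}=(\mathbf{x}_1,\ldots,\mathbf{x}_d)$, $\mathbf{x}_i=(x_{i,1},\ldots,x_{i,n_i})$, and $F_{i,j_i}$ for the components of $F$. $\mathbf{x}\le\mathbf{y}$ means $\mathbf{y}-\mathbf{x}\in\mathcal{K}_+$. For $\boldsymbol{\alpha}\in\mathbb{R}^d$, $\boldsymbol{\alpha}\otimes\mathbf{x}=(\alpha_1\mathbf{x}_1,\ldots,\alpha_d\mathbf{x}_d)$. For $\boldsymbol{\alpha}\in\mathbb{R}^d_{++}$ and $B\in\mathbb{R}^{d\times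 d}$, $\boldsymbol{\alpha}^B=(\prod_{k}\alpha_k^{B_{1,k}},\ldots,\prod_k\alpha_k^{B_{d,k}})$. $\mathbf{1}$ is the vector of all ones. $F\colon\mathcal{K}_+\to\mathcal{K}_+$ is order-preserving if $\mathbf{x}\le\mathbf{y}$ implies $F(\mathbf{x})\le F(\mathbf{y})$; it is multi-homogeneous with homogeneity matrix $\mathcal{A}(F)=A\in\mathbb{R}^{d\times d}$ if $F(\boldsymbol{\alpha}\otimes\mathbf{x})=\boldsymbol{\alpha}^A\otimes F(\mathbf{x})$ for all $\mathbf{x}\in\mathcal{K}_+$, $\boldsymbol{\alpha}\in\mathbb{R}^d_{++}$. $\mathcal{H}^d$ is the set of $F\colon\mathcal{K}_+\to\mathcal{K}_+$ that are continuous, order-preserving and multi-homogeneous, with $F(\mathbf{1})\in\mathcal{K}_{++}$ and such that $\mathcal{A}(F)$ has at least one nonzero entry per row. An eigenvector of $F$ is $\mathbf{x}$ with $\mathbf{x}_i\ne0$ for all $i$ and $F(\mathbf{x})=\boldsymbol{\lambda}\otimes\mathbf{x}$ for some $\boldsymbol{\lambda}\in\mathbb{R}^d$. For $(i,j_i)\in\mathcal{I}$ and $t\ge 0$ let $\mathbf{u}^{(i,j_i)}(t)\in\mathcal{K}_+$ be the vector whose $(i,j_i)$ component is $t$ and all of whose other components are $1$. $\mathcal{G}(F)$ is the directed graph with vertex set $\mathcal{I}$ and an edge from $(k,l_k)$ to $(i,j_i)$ if and only if $\lim_{t\to\infty}F_{k,l_k}(\mathbf{u}^{(i,j_i)}(t))=\infty$.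 $\mathcal{G}^-(F)$ is the directed graph with vertex set $\mathcal{I}$ and an edge from $(k,l_k)$ to $(i,j_i)$ if and only if $\lim_{t\to0}F_{k,l_k}(\mathbf{u}^{(i,j_i)}(t))=0$. For each $i$, $\|\cdot\|_{\gamma_i}$ is a norm on $\mathbb{R}^{n_i}$, assumed monotonic ($0\le\mathbf{x}_i\le\mathbf{y}_i$ implies $\|\mathbf{x}_i\|_{\gamma_i}\le\|\mathbf{y}_i\|_{\gamma_i}$), and $\mathcal{S}_{++}=\{\mathbf{x}\in\mathcal{K}_{++}:\|\mathbf{x}_i\|_{\gamma_i}=1\ \forall i\in[d]\}$. *)

theory Defs
  imports "HOL-Analysis.Analysis"
begin

text \<open>
  Tuples of \<open>R^{n_1} \<times> ... \<times> R^{n_d}\<close> are functions on \<open>nat \<times> nat\<close> that vanish outside the finite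
  index set \<open>Idx d n\<close>. On such functions the library's product topology is the Euclidean one, and
  the pointwise order \<open>x \<le> y\<close> says exactly that \<open>y - x\<close> lies in the cone \<open>Kplus d n\<close>.
  Elements of \<open>R^d\<close> and \<open>d \<times> d\<close> matrices are functions of which only the values at indices in
  \<open>{1..d}\<close> matter.
\<close>

type_synonym mvec = "nat \<times> nat \<Rightarrow> real"

definition Idx :: "nat \<Rightarrow> (nat \<Rightarrow> nat) \<Rightarrow> (nat \<times> nat) set" where
  "Idx d n = (SIGMA k:{1..d}. {1..n k})"

definition Kplus :: "nat \<Rightarrow> (nat \<Rightarrow> nat) \<Rightarrow> mvec set" where
  "Kplus d n = {x. (\<forall>p\<in>Idx d n. 0 \<le> x p) \<and> (\<forall>p. p \<notin> Idx d n \<longrightarrow> x p = 0)}"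

definition Kpp :: "nat \<Rightarrow> (nat \<Rightarrow> nat) \<Rightarrow> mvec set" where
  "Kpp d n = {x. (\<forall>p\<in>Idx d n. 0 < x p) \<and> (\<forall>p. p \<notin> Idx d n \<longrightarrow> x p = 0)}"

definition ones :: "nat \<Rightarrow> (nat \<Rightarrow> nat) \<Rightarrow> mvec" where
  "ones d n = indicator (Idx d n)"

definition block_scale :: "(nat \<Rightarrow> real) \<Rightarrow> mvec \<Rightarrow> mvec" (infixr \<open>\<otimes>\<^sub>b\<close> 70) where
  "\<alpha> \<otimes>\<^sub>b x = (\<lambda>(i, j). \<alpha> i * x (i, j))"

definition vec_powr :: "nat \<Rightarrow> (nat \<Rightarrow> real) \<Rightarrow> (nat \<Rightarrow> nat \<Rightarrow> real) \<Rightarrow> nat \<Rightarrow> real" where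
  "vec_powr d \<alpha> B = (\<lambda>i. \<Prod>k\<in>{1..d}. \<alpha> k powr B i k)"

definition multi_homogeneous ::
  "nat \<Rightarrow> (nat \<Rightarrow> nat) \<Rightarrow> (nat \<Rightarrow> nat \<Rightarrow> real) \<Rightarrow> (mvec \<Rightarrow> mvec) \<Rightarrow> bool" where
  "multi_homogeneous d n A F \<longleftrightarrow>
     (\<forall>x\<in>Kplus d n. \<forall>\<alpha>. (\<forall>i\<in>{1..d}. 0 < \<alpha> i) \<longrightarrow>
        F (\<alpha> \<otimes>\<^sub>b x) = vec_powr d \<alpha> A \<otimes>\<^sub>b F x)"

text \<open>
  \<open>Hclass d n A\<close> is the set of all \<open>F\<close> in \<open>H^d\<close> whose homogeneity matrix is \<open>A\<close>. The matrix is
  determined by \<open>F\<close>; see \<open>homogeneity_matrix_unique\<close> below.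
\<close>

definition Hclass ::
  "nat \<Rightarrow> (nat \<Rightarrow> nat) \<Rightarrow> (nat \<Rightarrow> nat \<Rightarrow> real) \<Rightarrow> (mvec \<Rightarrow> mvec) set" where
  "Hclass d n A = {F. F \<in> Kplus d n \<rightarrow> Kplus d n \<and> continuous_on (Kplus d n) F \<and>
     mono_on (Kplus d n) F \<and> multi_homogeneous d n A F \<and> F (ones d n) \<in> Kpp d n \<and>
     (\<forall>i\<in>{1..d}. \<exists>k\<in>{1..d}. A i k \<noteq> 0)}"

definition eigenvector :: "nat \<Rightarrow> (nat \<Rightarrow> nat) \<Rightarrow> (mvec \<Rightarrow> mvec) \<Rightarrow> mvec \<Rightarrow> bool" where
  "eigenvector d n F x \<longleftrightarrow> x \<in> Kplus d n \<and>
     (\<forall>i\<in>{1..d}. \<exists>j\<in>{1..n i}. x (i, j) \<noteq> 0) \<and> (\<exists>lam. F x = lam \<otimes>\<^sub>b x)"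

definition uvec :: "nat \<Rightarrow> (nat \<Rightarrow> nat) \<Rightarrow> nat \<times> nat \<Rightarrow> real \<Rightarrow> mvec" where
  "uvec d n q t = (ones d n)(q := t)"

text \<open>The directed graphs on \<open>Idx d n\<close> are given by their edge sets; since \<open>uvec\<close> requires
  \<open>t \<ge> 0\<close>, the limit \<open>t \<rightarrow> 0\<close> is one-sided.\<close>

definition Gup :: "nat \<Rightarrow> (nat \<Rightarrow> nat) \<Rightarrow> (mvec \<Rightarrow> mvec) \<Rightarrow> ((nat \<times> nat) \<times> (nat \<times> nat)) set" where
  "Gup d n F = {(p, q). p \<in> Idx d n \<and> q \<in> Idx d n \<and>
     filterlim (\<lambda>t. F (uvec d n q t) p) at_top at_top}"

definition Gdown :: "nat \<Rightarrow> (nat \<Rightarrow> nat) \<Rightarrow> (mvec \<Rightarrow> mvec) \<Rightarrow> ((nat \<times> nat) \<times> (nat \<times> nat)) set" where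
  "Gdown d n F = {(p, q). p \<in> Idx d n \<and> q \<in> Idx d n \<and>
     ((\<lambda>t. F (uvec d n q t) p) \<longlongrightarrow> 0) (at_right 0)}"

definition Rvec :: "nat \<Rightarrow> (nat \<Rightarrow> real) set" where
  "Rvec m = {v. \<forall>j. j \<notin> {1..m} \<longrightarrow> v j = 0}"

definition is_norm :: "nat \<Rightarrow> ((nat \<Rightarrow> real) \<Rightarrow> real) \<Rightarrow> bool" where
  "is_norm m N \<longleftrightarrow>
     (\<forall>v\<in>Rvec m. 0 \<le> N v \<and> (N v = 0 \<longleftrightarrow> v = (\<lambda>_. 0))) \<and>
     (\<forall>c. \<forall>v\<in>Rvec m. N (\<lambda>j. c * v j) = \<bar>c\<bar> * N v) \<and>
     (\<forall>v\<in>Rvec m. \<forall>w\<in>Rvec m. N (\<lambda>j. v j + w j) \<le> N v + N w)"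

definition monotonic_norm :: "nat \<Rightarrow> ((nat \<Rightarrow> real) \<Rightarrow> real) \<Rightarrow> bool" where
  "monotonic_norm m N \<longleftrightarrow> is_norm m N \<and>
     (\<forall>v\<in>Rvec m. \<forall>w\<in>Rvec m. (\<forall>j. 0 \<le> v j) \<and> v \<le> w \<longrightarrow> N v \<le> N w)"

definition Spp :: "nat \<Rightarrow> (nat \<Rightarrow> nat) \<Rightarrow> (nat \<Rightarrow> (nat \<Rightarrow> real) \<Rightarrow> real) \<Rightarrow> mvec set" where
  "Spp d n N = {x \<in> Kpp d n. \<forall>i\<in>{1..d}. N i (\<lambda>j. x (i, j)) = 1}"

lemma homogeneity_matrix_unique:
  assumes A: "multi_homogeneous d n A F" and B: "multi_homogeneous d n B F"
    and F1: "F (ones d n) \<in> Kpp d n" and n: "\<And>i. i \<in> {1..d} \<Longrightarrow> 0 < n i"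
    and i: "i \<in> {1..d}" and k: "k \<in> {1..d}"
  shows "A i k = B i k"
proof -
  define \<alpha> :: "nat \<Rightarrow> real" where "\<alpha> = (\<lambda>m. if m = k then 2 else 1)"
  have pos: "\<forall>m\<in>{1..d}. 0 < \<alpha> m" by (simp add: \<alpha>_def)
  have one: "ones d n \<in> Kplus d n" by (auto simp: ones_def Kplus_def indicator_def)
  have idx: "(i, 1) \<in> Idx d n" using i n[OF i] by (auto simp: Idx_def)
  have "vec_powr d \<alpha> A \<otimes>\<^sub>b F (ones d n) = vec_powr d \<alpha> B \<otimes>\<^sub>b F (ones d n)"
    using A B one pos unfolding multi_homogeneous_def by metis
  from fun_cong[OF this, of "(i, 1)"]
  have "vec_powr d \<alpha> A i * F (ones d n) (i, 1) = vec_powr d \<alpha> B i * F (ones d n) (i, 1)"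
    by (simp add: block_scale_def)
  moreover have "0 < F (ones d n) (i, 1)" using F1 idx by (auto simp: Kpp_def)
  ultimately have eq: "vec_powr d \<alpha> A i = vec_powr d \<alpha> B i" by simp
  have "vec_powr d \<alpha> C i = 2 powr C i k" for C :: "nat \<Rightarrow> nat \<Rightarrow> real"
  proof -
    have "vec_powr d \<alpha> C i = (\<Prod>m\<in>{1..d}. if m = k then 2 powr C i m else 1)"
      unfolding vec_powr_def by (intro prod.cong) (auto simp: \<alpha>_def)
    then show ?thesis using k by simp
  qed
  with eq show ?thesis by (simp add: powr_inj)
qed

end

theory Submission
  imports Defs
begin

text \<open>
  In the coordinates \<open>z = ln x\<close> the map \<open>F\<close> becomes \<open>f z = ln (F (exp z))\<close>, which is monotone and
  satisfies \<open>f (z + c) = f z + A c\<close> for every \<open>c\<close> that is constant on blocks. An eigenvector of \<open>F\<close> in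
  the interior of the cone is the same as a solution of \<open>f y = y + lam\<close> with \<open>lam\<close> constant on blocks.
  Monotonicity and the shift rule make \<open>f\<close> nonexpansive for the norm
  \<open>\<Sum>k. b k * (Max of \<bar>z\<bar> over block k)\<close>, because \<open>b\<close> is a left fixed vector of \<open>A\<close>. Hence \<open>\<theta> f\<close> is a
  contraction for \<open>0 \<le> \<theta> < 1\<close> and has a fixed point (\<open>discounted_fixed_point\<close>). After a block shift
  that moves the minimum of each block to 0, this is a vector \<open>y \<ge> 0\<close> with \<open>f y = s y + lam\<close>, where
  \<open>s = 1 / \<theta>\<close>. It remains to let \<open>s\<close> tend to 1, and for that the vectors \<open>y\<close> must stay bounded.

  This is where the graph enters. The numbers \<open>lam k\<close> are bounded above uniformly in \<open>s\<close>: they are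
  bounded below by evaluating the equation at the block minima, while evaluation at the block maxima
  and summation against \<open>b\<close> bounds their weighted sum above (\<open>scaled_eigenvalue_bounded\<close>). So a bound
  on \<open>y p\<close> bounds \<open>f y p\<close>, and if \<open>(p, q)\<close> is an edge, a bound on \<open>f y p\<close> bounds \<open>y q\<close>, since a large
  \<open>y q\<close> alone would force \<open>f y p\<close> to be large. Bounds thus travel along paths. They start at the block
  minima, where \<open>y = 0\<close>, and choosing one minimal index \<open>j k\<close> per block, the hypothesis gives a path
  from some \<open>(k, j k)\<close> to any given index (\<open>scaled_eigenvectors_bounded\<close>). A limit point of the
  vectors \<open>y\<close> solves the equation with \<open>s = 1\<close> (\<open>additive_eigenvector_exists\<close>).

  The second graph needs no second argument: the reflected map \<open>z \<mapsto> - f (- z)\<close> is monotone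
  with the same shift rule, edges for \<open>t \<rightarrow> 0\<close> become edges for \<open>t \<rightarrow> \<infinity>\<close>, and its additive
  eigenvectors are the negatives of those of \<open>f\<close>.
\<close>

section \<open>Convergent subsequences of bounded families\<close>

lemma bounded_family_convergent_subsequence:
  fixes y :: "nat \<Rightarrow> 'a \<Rightarrow> real"
  assumes "finite I" and "\<And>m p. p \<in> I \<Longrightarrow> \<bar>y m p\<bar> \<le> R"
  shows "\<exists>r. strict_mono r \<and> (\<forall>p\<in>I. convergent (\<lambda>m. y (r m) p))"
  using assms
proof (induction I rule: finite_induct)
  case empty
  show ?case by (intro exI[of _ id]) (simp add: strict_mono_def)
next
  case (insert a I)
  then obtain r where r: "strict_mono r" "\<forall>p\<in>I. convergent (\<lambda>m. y (r m) p)"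
    by auto
  have "bounded (range (\<lambda>m. y (r m) a))"
    unfolding bounded_iff using insert.prems by auto
  then obtain r' l where r': "strict_mono r'" "((\<lambda>m. y (r m) a) \<circ> r') \<longlonglongrightarrow> l"
    using bounded_imp_convergent_subsequence by blast
  have "convergent (\<lambda>m. y ((r \<circ> r') m) p)" if "p \<in> insert a I" for p
  proof (cases "p = a")
    case True
    then show ?thesis using r'(2) by (auto simp: convergent_def o_def)
  next
    case False
    then show ?thesis
      using convergent_subseq_convergent[OF _ r'(1), of "\<lambda>m. y (r m) p"] r(2) that
      by (auto simp: o_def)
  qed
  moreover have "strict_mono (r \<circ> r')" using r(1) r'(1) by (rule strict_mono_o)
  ultimately show ?case by blast
qed

section \<open>Multi-topical maps: nonexpansiveness\<close>

text \<open>
  The additive picture of an order-preserving multi-homogeneous map: \<open>I\<close> is the set of coordinates,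
  divided by \<open>blk\<close> into blocks indexed by \<open>D\<close>. Since \<open>blk\<close> is onto \<open>D\<close>, every block is nonempty.
  The values of \<open>f x\<close> on \<open>I\<close> depend only on those of \<open>x\<close> on \<open>I\<close>, by \<open>mono\<close>.
\<close>

locale multi_topical =
  fixes I :: "'a set" and D :: "'k set" and blk :: "'a \<Rightarrow> 'k"
    and A :: "'k \<Rightarrow> 'k \<Rightarrow> real" and b :: "'k \<Rightarrow> real"
    and f :: "('a \<Rightarrow> real) \<Rightarrow> 'a \<Rightarrow> real"
  assumes finI: "finite I" and blk: "blk ` I = D"
    and mono: "\<lbrakk>\<And>q. q \<in> I \<Longrightarrow> x q \<le> y q; p \<in> I\<rbrakk> \<Longrightarrow> f x p \<le> f y p"
    and shift: "p \<in> I \<Longrightarrow> f (\<lambda>q. x q + c (blk q)) p = f x p + (\<Sum>k\<in>D. A (blk p) k * c k)"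
    and b_pos: "k \<in> D \<Longrightarrow> 0 < b k"
    and b_fixed: "k \<in> D \<Longrightarrow> (\<Sum>i\<in>D. A i k * b i) = b k"
begin

lemma finD: "finite D"
  using finI blk by auto

lemma blk_in: "p \<in> I \<Longrightarrow> blk p \<in> D"
  using blk by auto

text \<open>
  Summation against \<open>b\<close> absorbs \<open>A\<close>, as \<open>b\<close> is a left fixed vector. This turns an estimate block by block into one for the weighted sum.
\<close>

lemma weighted_sum_invariant:
  "(\<Sum>i\<in>D. b i * (\<Sum>k\<in>D. A i k * c k)) = (\<Sum>k\<in>D. b k * c k)"
proof -
  have "(\<Sum>i\<in>D. b i * (\<Sum>k\<in>D. A i k * c k)) = (\<Sum>k\<in>D. \<Sum>i\<in>D. b i * (A i k * c k))"
    unfolding sum_distrib_left by (rule sum.swap)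
  also have "\<dots> = (\<Sum>k\<in>D. (\<Sum>i\<in>D. A i k * b i) * c k)"
    by (simp add: sum_distrib_left mult_ac)
  also have "\<dots> = (\<Sum>k\<in>D. b k * c k)"
    using b_fixed by simp
  finally show ?thesis .
qed

lemma shifted_upper_bound:
  assumes "\<And>q. q \<in> I \<Longrightarrow> x q \<le> y q + c (blk q)" and "p \<in> I"
  shows "f x p \<le> f y p + (\<Sum>k\<in>D. A (blk p) k * c k)"
  using mono[of x "\<lambda>q. y q + c (blk q)" p] assms shift[of p y c] by simp

lemma lipschitz:
  assumes "\<And>q. q \<in> I \<Longrightarrow> \<bar>x q - y q\<bar> \<le> c (blk q)" and "p \<in> I"
  shows "\<bar>f x p - f y p\<bar> \<le> (\<Sum>k\<in>D. A (blk p) k * c k)"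
proof -
  have "x q \<le> y q + c (blk q) \<and> y q \<le> x q + c (blk q)" if "q \<in> I" for q
    using assms(1)[OF that] by linarith
  then show ?thesis
    using shifted_upper_bound[of x y c p] shifted_upper_bound[of y x c p] assms(2) by (simp add: abs_le_iff)
qed

lemma tendsto_f:
  assumes lim: "\<And>q. q \<in> I \<Longrightarrow> (\<lambda>m. x m q) \<longlonglongrightarrow> y q" and p: "p \<in> I"
  shows "(\<lambda>m. f (x m) p) \<longlonglongrightarrow> f y p"
proof -
  define e where "e m = (\<Sum>q\<in>I. \<bar>x m q - y q\<bar>)" for m :: nat
  have "e \<longlonglongrightarrow> (\<Sum>q\<in>I. \<bar>y q - y q\<bar>)"
    unfolding e_def using lim by (intro tendsto_intros) auto
  then have "(\<lambda>m. \<Sum>k\<in>D. A (blk p) k * e m) \<longlonglongrightarrow> (\<Sum>k\<in>D. A (blk p) k * 0)"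
    by (intro tendsto_intros) simp
  moreover have "\<bar>f (x m) p - f y p\<bar> \<le> (\<Sum>k\<in>D. A (blk p) k * e m)" for m
  proof (rule lipschitz[OF _ p, where c = "\<lambda>_. e m"])
    show "\<bar>x m q - y q\<bar> \<le> e m" if "q \<in> I" for q
      unfolding e_def using finI that by (intro member_le_sum) auto
  qed
  ultimately have "(\<lambda>m. f (x m) p - f y p) \<longlonglongrightarrow> 0"
    by (auto intro: Lim_null_comparison[where g = "\<lambda>m. \<Sum>k\<in>D. A (blk p) k * e m"])
  then show ?thesis by (simp add: LIM_zero_iff)
qed

section \<open>Eigenvectors of a discounted map\<close>

text \<open>
  Picard iteration from 0. The successive differences are controlled by block constants \<open>c m\<close> which
  obey \<open>c (m + 1) = \<theta> A (c m)\<close>, so their sum weighted by \<open>b\<close> is multiplied by \<open>\<theta>\<close> in each step; this is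
  the contraction argument for the weighted norm.
\<close>

lemma discounted_fixed_point:
  fixes \<theta> :: real
  assumes \<theta>: "0 \<le> \<theta>" "\<theta> < 1"
  shows "\<exists>z. \<forall>p\<in>I. z p = \<theta> * f z p"
proof -
  define Z where "Z m = ((\<lambda>z p. \<theta> * f z p) ^^ m) (\<lambda>_. 0)" for m :: nat
  have Z0: "Z 0 = (\<lambda>_. 0)" and ZS: "Z (Suc m) p = \<theta> * f (Z m) p" for m p
    by (simp_all add: Z_def)
  define C0 where "C0 = (\<Sum>p\<in>I. \<bar>Z 1 p\<bar>)"
  define c where "c m = ((\<lambda>u k. \<theta> * (\<Sum>l\<in>D. A k l * u l)) ^^ m) (\<lambda>_. C0)" for m :: nat
  have c0: "c 0 k = C0" and cS: "c (Suc m) k = \<theta> * (\<Sum>l\<in>D. A k l * c m l)" for m k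
    by (simp_all add: c_def)
  have step: "\<bar>Z (Suc m) p - Z m p\<bar> \<le> c m (blk p)" if "p \<in> I" for m p
    using that
  proof (induction m arbitrary: p)
    case 0
    then show ?case
      unfolding Z0 c0 C0_def using finI member_le_sum[of p I "\<lambda>p. \<bar>Z 1 p\<bar>"] by simp
  next
    case (Suc m)
    have "\<bar>Z (Suc (Suc m)) p - Z (Suc m) p\<bar> = \<theta> * \<bar>f (Z (Suc m)) p - f (Z m) p\<bar>"
      unfolding ZS[of "Suc m"] ZS[of m] using \<theta>
      by (simp add: right_diff_distrib[symmetric] abs_mult)
    also have "\<dots> \<le> c (Suc m) (blk p)"
      unfolding cS using lipschitz[of "Z (Suc m)" "Z m" "c m" p] Suc \<theta> by (intro mult_left_mono) auto
    finally show ?case .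
  qed
  \<comment> \<open>Since every block has a coordinate, \<open>c m k\<close> bounds some absolute value.\<close>
  have c_nonneg: "0 \<le> c m k" if k: "k \<in> D" for m k
  proof -
    obtain p where "p \<in> I" "blk p = k" using k blk by auto
    then show ?thesis using step[of p m] by auto
  qed
  have weight: "(\<Sum>k\<in>D. b k * c m k) = \<theta> ^ m * (\<Sum>k\<in>D. b k * C0)" for m
  proof (induction m)
    case 0
    show ?case by (simp add: c0)
  next
    case (Suc m)
    have "(\<Sum>k\<in>D. b k * c (Suc m) k) = \<theta> * (\<Sum>k\<in>D. b k * (\<Sum>l\<in>D. A k l * c m l))"
      by (simp add: cS sum_distrib_left mult_ac)
    then show ?case using Suc weighted_sum_invariant by simp
  qed
  have conv: "convergent (\<lambda>m. Z m p)" if p: "p \<in> I" for p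
  proof -
    define B where "B = (\<Sum>k\<in>D. b k * C0) / b (blk p)"
    have bp: "0 < b (blk p)" using b_pos blk_in p by blast
    have "norm (Z (Suc m) p - Z m p) \<le> B * \<theta> ^ m" for m
    proof -
      have "b (blk p) * c m (blk p) \<le> (\<Sum>k\<in>D. b k * c m k)"
        using finD blk_in[OF p] b_pos c_nonneg
        by (intro member_le_sum) (auto intro: mult_nonneg_nonneg simp: less_imp_le)
      then have "c m (blk p) \<le> B * \<theta> ^ m"
        using bp by (simp add: weight B_def field_simps)
      then show ?thesis using step[OF p, of m] by simp
    qed
    moreover have "summable (\<lambda>m. B * \<theta> ^ m)"
      using \<theta> by (intro summable_mult summable_geometric) auto
    ultimately have "summable (\<lambda>m. Z (Suc m) p - Z m p)"
      by (rule summable_comparison_test'[where N = 0, rotated])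
    then have "convergent (\<lambda>m. \<Sum>i<m. Z (Suc i) p - Z i p)"
      by (simp add: summable_iff_convergent)
    moreover have "(\<Sum>i<m. Z (Suc i) p - Z i p) = Z m p" for m
      by (subst sum_lessThan_telescope) (simp add: Z0)
    ultimately show ?thesis by simp
  qed
  define z where "z p = lim (\<lambda>m. Z m p)" for p
  have lim: "(\<lambda>m. Z m p) \<longlonglongrightarrow> z p" if "p \<in> I" for p
    unfolding z_def using conv[OF that] by (rule convergent_LIMSEQ_iff[THEN iffD1])
  have "z p = \<theta> * f z p" if p: "p \<in> I" for p
  proof (rule LIMSEQ_unique)
    show "(\<lambda>m. Z (Suc m) p) \<longlonglongrightarrow> z p" using lim[OF p] by (rule LIMSEQ_Suc)
    show "(\<lambda>m. Z (Suc m) p) \<longlonglongrightarrow> \<theta> * f z p"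
      unfolding ZS using tendsto_f[OF lim p] by (intro tendsto_intros)
  qed
  then show ?thesis by blast
qed

text \<open>
  The normalisation puts the minimum of each block at exactly 0. The zeros are the
  starting points from which bounds are carried along paths.
\<close>

definition scaled_eigenpair :: "real \<Rightarrow> ('a \<Rightarrow> real) \<Rightarrow> ('k \<Rightarrow> real) \<Rightarrow> bool" where
  "scaled_eigenpair s y lam \<longleftrightarrow>
     (\<forall>p\<in>I. f y p = s * y p + lam (blk p)) \<and> (\<forall>p\<in>I. 0 \<le> y p) \<and>
     (\<forall>k\<in>D. \<exists>p\<in>I. blk p = k \<and> y p = 0)"

lemma scaled_eigenpair_exists:
  assumes s: "1 < s"
  shows "\<exists>y lam. scaled_eigenpair s y lam"
proof -
  obtain z where z: "\<forall>p\<in>I. z p = (1 / s) * f z p"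
    using discounted_fixed_point[of "1 / s"] s by auto
  define c where "c k = Min (z ` {p \<in> I. blk p = k})" for k
  define y where "y p = z p - c (blk p)" for p
  define lam where "lam k = s * c k - (\<Sum>l\<in>D. A k l * c l)" for k
  have "f y p = s * y p + lam (blk p)" if p: "p \<in> I" for p
  proof -
    have "f z p = s * z p" using bspec[OF z p] s by (simp add: field_simps)
    moreover have "f z p = f y p + (\<Sum>l\<in>D. A (blk p) l * c l)"
      using shift[OF p, of y c] by (simp add: y_def)
    ultimately show ?thesis by (simp add: lam_def y_def algebra_simps)
  qed
  moreover have "0 \<le> y p" if "p \<in> I" for p
    unfolding y_def c_def using finI that by simp
  moreover have "\<exists>p\<in>I. blk p = k \<and> y p = 0" if "k \<in> D" for k
  proof -
    have "c k \<in> z ` {p \<in> I. blk p = k}"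
      unfolding c_def using finI that blk by (intro Min_in) auto
    then show ?thesis by (auto simp: y_def)
  qed
  ultimately show ?thesis unfolding scaled_eigenpair_def by blast
qed

section \<open>Bounds along paths\<close>

text \<open>
  At a block minimum \<open>lam k = f y p \<ge> f 0 p\<close>, which bounds \<open>lam\<close> below. At a block maximum \<open>M k\<close>,
  \<open>s * M k + lam k \<le> C + (A M) k\<close>; in the sum against \<open>b\<close> the terms in \<open>M\<close> cancel up to a
  contribution of the favourable sign, as \<open>s \<ge> 1\<close> and \<open>M \<ge> 0\<close>. A weighted sum that is bounded above,
  with all terms bounded below, has each term bounded above.
\<close>

lemma scaled_eigenvalue_bounded:
  "\<exists>L. \<forall>s y lam k. 1 \<le> s \<longrightarrow> scaled_eigenpair s y lam \<longrightarrow> k \<in> D \<longrightarrow> lam k \<le> L"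
proof -
  define C where "C = (\<Sum>p\<in>I. \<bar>f (\<lambda>_. 0) p\<bar>)"
  define W where "W = (\<Sum>k\<in>D. b k)"
  define L where "L = (\<Sum>k\<in>D. 2 * C * W / b k)"
  have C: "\<bar>f (\<lambda>_. 0) p\<bar> \<le> C" if "p \<in> I" for p
    unfolding C_def using finI that member_le_sum[of p I "\<lambda>p. \<bar>f (\<lambda>_. 0) p\<bar>"] by simp
  have C0: "0 \<le> C" unfolding C_def by (intro sum_nonneg) simp
  have W0: "0 \<le> W" unfolding W_def using b_pos by (intro sum_nonneg) (auto intro: less_imp_le)
  have "lam k \<le> L" if s: "1 \<le> s" and se: "scaled_eigenpair s y lam" and k: "k \<in> D" for s y lam k
  proof -
    have eq: "f y p = s * y p + lam (blk p)" and y0: "0 \<le> y p" if "p \<in> I" for p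
      using se that unfolding scaled_eigenpair_def by auto
    have low: "- C \<le> lam i" if i: "i \<in> D" for i
    proof -
      obtain p where p: "p \<in> I" "blk p = i" "y p = 0"
        using se i unfolding scaled_eigenpair_def by blast
      have "- C \<le> f (\<lambda>_. 0) p" using C[OF p(1)] by linarith
      also have "\<dots> \<le> f y p" using y0 p(1) by (intro mono) auto
      finally show ?thesis using eq[OF p(1)] p by simp
    qed
    define M where "M i = Max (y ` {p \<in> I. blk p = i})" for i
    have yM: "y p \<le> M (blk p)" if "p \<in> I" for p
      unfolding M_def using finI that by simp
    have up: "M i + lam i \<le> C + (\<Sum>l\<in>D. A i l * M l)" if "i \<in> D" for i
    proof -
      have "M i \<in> y ` {p \<in> I. blk p = i}"
        unfolding M_def using finI that blk by (intro Max_in) auto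
      then obtain p where p: "p \<in> I" "blk p = i" "y p = M i" by auto
      have "f y p \<le> f (\<lambda>_. 0) p + (\<Sum>l\<in>D. A (blk p) l * M l)"
        using yM p(1) by (intro shifted_upper_bound) auto
      then have "s * M i + lam i \<le> C + (\<Sum>l\<in>D. A i l * M l)"
        using C[OF p(1)] eq[OF p(1)] p by auto
      moreover have "1 * M i \<le> s * M i"
        using s y0[OF p(1)] p(3) by (intro mult_right_mono) auto
      ultimately show ?thesis by linarith
    qed
    \<comment> \<open>The weighted sums of \<open>M\<close> and \<open>A M\<close> agree, and adding \<open>C\<close> makes all terms nonnegative.\<close>
    have "(\<Sum>i\<in>D. b i * (M i + lam i)) \<le> (\<Sum>i\<in>D. b i * (C + (\<Sum>l\<in>D. A i l * M l)))"
      using up b_pos by (intro sum_mono mult_left_mono) (auto intro: less_imp_le)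
    then have "(\<Sum>i\<in>D. b i * lam i) \<le> (\<Sum>i\<in>D. b i * C)"
      using weighted_sum_invariant[of M] by (simp add: distrib_left sum.distrib)
    then have "(\<Sum>i\<in>D. b i * (lam i + C)) \<le> 2 * C * W"
      by (simp add: distrib_left sum.distrib W_def sum_distrib_right[symmetric] mult.commute[of C])
    moreover have "b k * (lam k + C) \<le> (\<Sum>i\<in>D. b i * (lam i + C))"
    proof (rule member_le_sum[OF k _ finD])
      show "0 \<le> b i * (lam i + C)" if "i \<in> D - {k}" for i
        using low[of i] b_pos[of i] that by simp
    qed
    ultimately have "b k * (lam k + C) \<le> 2 * C * W" by linarith
    then have "lam k + C \<le> 2 * C * W / b k"
      using b_pos[OF k] by (simp add: field_simps)
    also have "\<dots> \<le> L" unfolding L_def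
    proof (rule member_le_sum[OF k _ finD])
      show "0 \<le> 2 * C * W / b i" if "i \<in> D - {k}" for i
        using b_pos[of i] that C0 W0 by simp
    qed
    finally show ?thesis using C0 by linarith
  qed
  then show ?thesis by blast
qed

text \<open>
  Since \<open>y \<ge> 0\<close>, it dominates the vector with the single entry \<open>y q\<close>, so \<open>f y p\<close> would exceed
  \<open>2 * R + L\<close> if \<open>y q\<close> were large. But \<open>f y p = s * y p + lam (blk p)\<close> with \<open>s \<le> 2\<close> is at most that.
  The threshold does not depend on \<open>s\<close>, \<open>y\<close> or \<open>lam\<close>, which is the point of the order of quantifiers.
\<close>

lemma edge_propagates_bound:
  assumes p: "p \<in> I" and q: "q \<in> I"
    and edge: "filterlim (\<lambda>t. f ((\<lambda>_. 0)(q := t)) p) at_top at_top"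
  shows "\<exists>R'. \<forall>s y lam. s \<le> 2 \<longrightarrow> scaled_eigenpair s y lam \<longrightarrow>
           lam (blk p) \<le> L \<longrightarrow> y p \<le> R \<longrightarrow> y q \<le> R'"
proof -
  obtain T where T: "\<And>t. T \<le> t \<Longrightarrow> 2 * R + L < f ((\<lambda>_. 0)(q := t)) p"
    using edge unfolding filterlim_at_top_dense eventually_at_top_linorder by blast
  have "y q \<le> T"
    if s: "s \<le> 2" and se: "scaled_eigenpair s y lam" and "lam (blk p) \<le> L" "y p \<le> R" for s y lam
  proof (rule ccontr)
    assume "\<not> y q \<le> T"
    then have "2 * R + L < f ((\<lambda>_. 0)(q := y q)) p" by (intro T) simp
    also have "\<dots> \<le> f y p"
      using se p unfolding scaled_eigenpair_def by (intro mono) auto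
    also have "\<dots> = s * y p + lam (blk p)"
      using se p unfolding scaled_eigenpair_def by auto
    also have "\<dots> \<le> 2 * y p + L"
      using se s p that unfolding scaled_eigenpair_def by (intro add_mono mult_right_mono) auto
    finally show False using that by simp
  qed
  then show ?thesis by blast
qed

lemma path_propagates_bound:
  assumes edge: "\<And>p q. (p, q) \<in> G \<Longrightarrow>
      p \<in> I \<and> q \<in> I \<and> filterlim (\<lambda>t. f ((\<lambda>_. 0)(q := t)) p) at_top at_top"
    and path: "(p, q) \<in> G\<^sup>*"
  shows "\<exists>R'. \<forall>s y lam. s \<le> 2 \<longrightarrow> scaled_eigenpair s y lam \<longrightarrow>
           (\<forall>k\<in>D. lam k \<le> L) \<longrightarrow> y p \<le> R \<longrightarrow> y q \<le> R'"
  using path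
proof (induction rule: rtrancl_induct)
  case base
  show ?case by blast
next
  case (step q r)
  then obtain R1 where R1: "\<forall>s y lam. s \<le> 2 \<longrightarrow> scaled_eigenpair s y lam \<longrightarrow>
      (\<forall>k\<in>D. lam k \<le> L) \<longrightarrow> y p \<le> R \<longrightarrow> y q \<le> R1" by blast
  have q: "q \<in> I" "r \<in> I" "filterlim (\<lambda>t. f ((\<lambda>_. 0)(r := t)) q) at_top at_top"
    using edge[OF step.hyps(2)] by auto
  obtain R2 where "\<forall>s y lam. s \<le> 2 \<longrightarrow> scaled_eigenpair s y lam \<longrightarrow>
      lam (blk q) \<le> L \<longrightarrow> y q \<le> R1 \<longrightarrow> y r \<le> R2"
    using edge_propagates_bound[OF q] by blast
  then show ?case using R1 blk_in[OF q(1)] by blast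
qed

text \<open>
  The zeros \<open>j k\<close> of \<open>y\<close> vary with \<open>y\<close>, but the bound carried along a path depends only on its end
  points, of which there are finitely many.
\<close>

lemma scaled_eigenvectors_bounded:
  assumes edge: "\<And>p q. (p, q) \<in> G \<Longrightarrow>
      p \<in> I \<and> q \<in> I \<and> filterlim (\<lambda>t. f ((\<lambda>_. 0)(q := t)) p) at_top at_top"
    and reach: "\<And>j q. \<lbrakk>\<And>k. k \<in> D \<Longrightarrow> j k \<in> I \<and> blk (j k) = k; q \<in> I\<rbrakk> \<Longrightarrow>
      \<exists>k\<in>D. (j k, q) \<in> G\<^sup>*"
  shows "\<exists>R. \<forall>s y lam. 1 \<le> s \<longrightarrow> s \<le> 2 \<longrightarrow> scaled_eigenpair s y lam \<longrightarrow> (\<forall>q\<in>I. y q \<le> R)"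
proof -
  obtain L where L: "\<forall>s y lam k. 1 \<le> s \<longrightarrow> scaled_eigenpair s y lam \<longrightarrow> k \<in> D \<longrightarrow> lam k \<le> L"
    using scaled_eigenvalue_bounded by blast
  have "\<forall>pq\<in>G\<^sup>*. \<exists>R'. \<forall>s y lam. s \<le> 2 \<longrightarrow> scaled_eigenpair s y lam \<longrightarrow>
           (\<forall>k\<in>D. lam k \<le> L) \<longrightarrow> y (fst pq) \<le> 0 \<longrightarrow> y (snd pq) \<le> R'"
    using path_propagates_bound[of G _ _ L 0, OF edge] by auto
  then obtain \<rho> where \<rho>: "\<And>pq s y lam. \<lbrakk>pq \<in> G\<^sup>*; s \<le> 2; scaled_eigenpair s y lam;
      \<forall>k\<in>D. lam k \<le> L; y (fst pq) \<le> 0\<rbrakk> \<Longrightarrow> y (snd pq) \<le> \<rho> pq"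
    by metis
  define R where "R = (\<Sum>pq\<in>I \<times> I. \<bar>\<rho> pq\<bar>)"
  have "y q \<le> R" if s: "1 \<le> s" "s \<le> 2" and se: "scaled_eigenpair s y lam" and q: "q \<in> I"
    for s y lam q
  proof -
    have "\<forall>k\<in>D. \<exists>p. p \<in> I \<and> blk p = k \<and> y p = 0"
      using se unfolding scaled_eigenpair_def by blast
    then obtain j where j: "\<And>k. k \<in> D \<Longrightarrow> j k \<in> I \<and> blk (j k) = k \<and> y (j k) = 0"
      by metis
    then obtain k where k: "k \<in> D" "(j k, q) \<in> G\<^sup>*" using reach[OF _ q] by blast
    have "y q \<le> \<rho> (j k, q)"
      using \<rho>[OF k(2) s(2) se] L s(1) se j[OF k(1)] by auto
    also have "\<dots> \<le> \<bar>\<rho> (j k, q)\<bar>" by simp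
    also have "\<dots> \<le> R"
      unfolding R_def using finI j[OF k(1)] q by (intro member_le_sum) auto
    finally show ?thesis .
  qed
  then show ?thesis by blast
qed

section \<open>Additive eigenvectors of multi-topical maps\<close>

theorem additive_eigenvector_exists:
  assumes edge: "\<And>p q. (p, q) \<in> G \<Longrightarrow>
      p \<in> I \<and> q \<in> I \<and> filterlim (\<lambda>t. f ((\<lambda>_. 0)(q := t)) p) at_top at_top"
    and reach: "\<And>j q. \<lbrakk>\<And>k. k \<in> D \<Longrightarrow> j k \<in> I \<and> blk (j k) = k; q \<in> I\<rbrakk> \<Longrightarrow>
      \<exists>k\<in>D. (j k, q) \<in> G\<^sup>*"
  shows "\<exists>y lam. \<forall>p\<in>I. f y p = y p + lam (blk p)"
proof -
  define s where "s m = 1 + 1 / real (Suc m)" for m :: nat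
  have s: "1 < s m" "s m \<le> 2" for m by (auto simp: s_def)
  have s_lim: "s \<longlonglongrightarrow> 1"
    unfolding s_def using tendsto_add[OF tendsto_const LIMSEQ_inverse_real_of_nat, of 1]
    by (simp add: inverse_eq_divide)
  obtain R where R: "\<forall>s y lam. 1 \<le> s \<longrightarrow> s \<le> 2 \<longrightarrow> scaled_eigenpair s y lam \<longrightarrow> (\<forall>q\<in>I. y q \<le> R)"
    using scaled_eigenvectors_bounded[OF edge reach] by blast
  have "\<forall>m. \<exists>y lam. scaled_eigenpair (s m) y lam"
    using scaled_eigenpair_exists s by blast
  then obtain Y Lam where Y: "\<And>m. scaled_eigenpair (s m) (Y m) (Lam m)" by metis
  have bd: "\<bar>Y m p\<bar> \<le> R" if "p \<in> I" for m p
    using R s[of m] Y[of m] that unfolding scaled_eigenpair_def by (auto intro: less_imp_le)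
  obtain r where r: "strict_mono r" "\<forall>p\<in>I. convergent (\<lambda>m. Y (r m) p)"
    using bounded_family_convergent_subsequence[of I Y R, OF finI bd] by blast
  define y where "y p = lim (\<lambda>m. Y (r m) p)" for p
  have y_lim: "(\<lambda>m. Y (r m) p) \<longlonglongrightarrow> y p" if "p \<in> I" for p
    unfolding y_def using r(2) that convergent_LIMSEQ_iff by blast
  have sr_lim: "(\<lambda>m. s (r m)) \<longlonglongrightarrow> 1"
    using LIMSEQ_subseq_LIMSEQ[OF s_lim r(1)] by (simp add: o_def)
  \<comment> \<open>The left-hand side depends on \<open>p\<close> only through its block, hence so does the limit.\<close>
  have lam_lim: "(\<lambda>m. Lam (r m) (blk p)) \<longlonglongrightarrow> f y p - y p" if p: "p \<in> I" for p
  proof -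
    have "(\<lambda>m. f (Y (r m)) p - s (r m) * Y (r m) p) \<longlonglongrightarrow> f y p - 1 * y p"
      by (intro tendsto_intros tendsto_f y_lim sr_lim p)
    moreover have "f (Y (r m)) p - s (r m) * Y (r m) p = Lam (r m) (blk p)" for m
      using Y[of "r m"] p unfolding scaled_eigenpair_def by simp
    ultimately show ?thesis by simp
  qed
  have "f y p = y p + lim (\<lambda>m. Lam (r m) (blk p))" if "p \<in> I" for p
    using limI[OF lam_lim[OF that]] by simp
  then show ?thesis by (intro exI[of _ y] exI[of _ "\<lambda>k. lim (\<lambda>m. Lam (r m) k)"]) blast
qed

lemma reflection_multi_topical: "multi_topical I D blk A b (\<lambda>x p. - f (\<lambda>q. - x q) p)"
proof
  show "- f (\<lambda>q. - x q) p \<le> - f (\<lambda>q. - y q) p" if "\<And>q. q \<in> I \<Longrightarrow> x q \<le> y q" "p \<in> I" for x y p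
    using mono[of "\<lambda>q. - y q" "\<lambda>q. - x q" p] that by simp
  show "- f (\<lambda>q. - (x q + c (blk q))) p = - f (\<lambda>q. - x q) p + (\<Sum>k\<in>D. A (blk p) k * c k)"
    if "p \<in> I" for p x c
    using shift[OF that, of "\<lambda>q. - x q" "\<lambda>k. - c k"] by (simp add: sum_negf)
qed (fact finI blk b_pos b_fixed)+

end

section \<open>Logarithmic coordinates\<close>

definition exp_vec :: "nat \<Rightarrow> (nat \<Rightarrow> nat) \<Rightarrow> mvec \<Rightarrow> mvec" where
  "exp_vec d n z = (\<lambda>p. if p \<in> Idx d n then exp (z p) else 0)"

definition log_conj :: "nat \<Rightarrow> (nat \<Rightarrow> nat) \<Rightarrow> (mvec \<Rightarrow> mvec) \<Rightarrow> mvec \<Rightarrow> mvec" where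
  "log_conj d n F z p = ln (F (exp_vec d n z) p)"

lemma Kpp_subset_Kplus: "Kpp d n \<subseteq> Kplus d n"
  by (auto simp: Kpp_def Kplus_def intro: less_imp_le)

lemma finite_Idx: "finite (Idx d n)"
  by (simp add: Idx_def)

lemma exp_vec_in_Kpp: "exp_vec d n z \<in> Kpp d n"
  by (auto simp: exp_vec_def Kpp_def)

lemma vec_powr_pos:
  assumes "\<forall>k\<in>{1..d}. 0 < \<alpha> k"
  shows "0 < vec_powr d \<alpha> B i"
  unfolding vec_powr_def using assms by (intro prod_pos) (auto simp: less_le)

text \<open>
  A positive vector dominates a positive multiple of \<open>ones d n\<close>, whose image is positive by
  homogeneity. This is what makes the logarithm of \<open>F (exp z)\<close> meaningful.
\<close>

lemma Hclass_maps_Kpp: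
  assumes F: "F \<in> Hclass d n A" and x: "x \<in> Kpp d n"
  shows "F x \<in> Kpp d n"
proof -
  have maps: "F \<in> Kplus d n \<rightarrow> Kplus d n" and mono: "mono_on (Kplus d n) F"
    and hom: "multi_homogeneous d n A F" and F1: "F (ones d n) \<in> Kpp d n"
    using F by (auto simp: Hclass_def)
  \<comment> \<open>The inserted 1 keeps the minimum positive even if the index set is empty.\<close>
  define m where "m = Min (insert 1 (x ` Idx d n))"
  have m: "0 < m" "\<And>p. p \<in> Idx d n \<Longrightarrow> m \<le> x p"
    unfolding m_def using finite_Idx[of d n] x by (auto simp: Kpp_def)
  have one: "ones d n \<in> Kplus d n" by (auto simp: ones_def Kplus_def indicator_def)
  have xK: "x \<in> Kplus d n" using x Kpp_subset_Kplus by blast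
  have le: "(\<lambda>_. m) \<otimes>\<^sub>b ones d n \<le> x"
    using m x by (auto simp: le_fun_def block_scale_def ones_def indicator_def Kpp_def)
  have "(\<lambda>_. m) \<otimes>\<^sub>b ones d n \<in> Kplus d n"
    using one m by (auto simp: block_scale_def Kplus_def)
  with le have "F ((\<lambda>_. m) \<otimes>\<^sub>b ones d n) \<le> F x"
    using mono xK by (auto dest: mono_onD)
  moreover have "F ((\<lambda>_. m) \<otimes>\<^sub>b ones d n) = vec_powr d (\<lambda>_. m) A \<otimes>\<^sub>b F (ones d n)"
    using hom one m unfolding multi_homogeneous_def by auto
  ultimately have "vec_powr d (\<lambda>_. m) A (fst p) * F (ones d n) p \<le> F x p" for p
    by (cases p) (auto simp: le_fun_def block_scale_def)
  moreover have "0 < vec_powr d (\<lambda>_. m) A (fst p) * F (ones d n) p" if "p \<in> Idx d n" for p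
    using vec_powr_pos[of d "\<lambda>_. m" A "fst p"] m(1) F1 that by (simp add: Kpp_def)
  ultimately have "0 < F x p" if "p \<in> Idx d n" for p
    using that by (meson less_le_trans)
  moreover have "F x \<in> Kplus d n" using maps xK by blast
  ultimately show ?thesis by (simp add: Kpp_def Kplus_def)
qed

lemma exp_log_conj:
  assumes "F \<in> Hclass d n A" and "p \<in> Idx d n"
  shows "F (exp_vec d n z) p = exp (log_conj d n F z p)"
  using Hclass_maps_Kpp[OF assms(1) exp_vec_in_Kpp[of d n z]] assms(2)
  by (simp add: log_conj_def Kpp_def)

lemma log_conj_multi_topical:
  assumes n: "\<forall>i\<in>{1..d}. 0 < n i" and F: "F \<in> Hclass d n A"
    and b: "\<forall>i\<in>{1..d}. 0 < b i" "\<forall>k\<in>{1..d}. (\<Sum>i\<in>{1..d}. A i k * b i) = b k"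
  shows "multi_topical (Idx d n) {1..d} fst A b (log_conj d n F)"
proof
  show "finite (Idx d n)" by (rule finite_Idx)
  have "(i, 1) \<in> Idx d n" if "i \<in> {1..d}" for i
    using n that by (force simp: Idx_def)
  then have "{1..d} \<subseteq> fst ` Idx d n" by (metis fst_conv image_eqI subsetI)
  moreover have "fst ` Idx d n \<subseteq> {1..d}" by (auto simp: Idx_def)
  ultimately show "fst ` Idx d n = {1..d}" by blast
  show "log_conj d n F x p \<le> log_conj d n F y p"
    if le: "\<And>q. q \<in> Idx d n \<Longrightarrow> x q \<le> y q" and p: "p \<in> Idx d n" for x y p
  proof -
    have "exp_vec d n x \<le> exp_vec d n y" using le by (auto simp: exp_vec_def le_fun_def)
    moreover have "mono_on (Kplus d n) F" using F by (simp add: Hclass_def)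
    moreover have "exp_vec d n z \<in> Kplus d n" for z
      using exp_vec_in_Kpp Kpp_subset_Kplus by blast
    ultimately have "F (exp_vec d n x) \<le> F (exp_vec d n y)"
      unfolding mono_on_def by blast
    then have "F (exp_vec d n x) p \<le> F (exp_vec d n y) p" by (rule le_funD)
    then show ?thesis using exp_log_conj[OF F p] by simp
  qed
  show "log_conj d n F (\<lambda>q. x q + c (fst q)) p = log_conj d n F x p + (\<Sum>k\<in>{1..d}. A (fst p) k * c k)"
    if p: "p \<in> Idx d n" for p x c
  proof -
    have "exp_vec d n (\<lambda>q. x q + c (fst q)) = (\<lambda>i. exp (c i)) \<otimes>\<^sub>b exp_vec d n x"
      by (auto simp: exp_vec_def block_scale_def exp_add)
    moreover have "F ((\<lambda>i. exp (c i)) \<otimes>\<^sub>b exp_vec d n x)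
        = vec_powr d (\<lambda>i. exp (c i)) A \<otimes>\<^sub>b F (exp_vec d n x)"
    proof -
      have "multi_homogeneous d n A F" using F by (simp add: Hclass_def)
      moreover have "exp_vec d n x \<in> Kplus d n" using exp_vec_in_Kpp Kpp_subset_Kplus by blast
      ultimately show ?thesis by (simp add: multi_homogeneous_def)
    qed
    moreover have "vec_powr d (\<lambda>i. exp (c i)) A i = exp (\<Sum>k\<in>{1..d}. A i k * c k)" for i
      by (simp add: vec_powr_def powr_def exp_sum)
    ultimately have "F (exp_vec d n (\<lambda>q. x q + c (fst q))) p
        = exp (\<Sum>k\<in>{1..d}. A (fst p) k * c k) * F (exp_vec d n x) p"
      by (cases p) (simp add: block_scale_def)
    then have "exp (log_conj d n F (\<lambda>q. x q + c (fst q)) p)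
        = exp (log_conj d n F x p + (\<Sum>k\<in>{1..d}. A (fst p) k * c k))"
      unfolding exp_log_conj[OF F p] by (simp add: exp_add)
    then show ?thesis by simp
  qed
qed (use b in auto)

lemma exp_vec_coordinate_line:
  assumes "q \<in> Idx d n"
  shows "exp_vec d n ((\<lambda>_. 0)(q := t)) = uvec d n q (exp t)"
  using assms by (auto simp: exp_vec_def uvec_def ones_def indicator_def)

lemma Gup_edge_log:
  assumes e: "(p, q) \<in> Gup d n F"
  shows "filterlim (\<lambda>t. log_conj d n F ((\<lambda>_. 0)(q := t)) p) at_top at_top"
proof -
  have q: "q \<in> Idx d n" and lim: "filterlim (\<lambda>t. F (uvec d n q t) p) at_top at_top"
    using e by (auto simp: Gup_def)
  show ?thesis
    unfolding log_conj_def exp_vec_coordinate_line[OF q]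
    by (intro filterlim_compose[OF ln_at_top] filterlim_compose[OF lim] exp_at_top)
qed

text \<open>
  The substitution \<open>t \<mapsto> exp (- t)\<close> turns a limit at \<open>0\<close> from the right into one at infinity, and \<open>- ln\<close>
  sends positive values tending to 0 to infinity.
\<close>

lemma Gdown_edge_log:
  assumes F: "F \<in> Hclass d n A" and e: "(p, q) \<in> Gdown d n F"
  shows "filterlim (\<lambda>t. - log_conj d n F (\<lambda>r. - ((\<lambda>_. 0)(q := t)) r) p) at_top at_top"
proof -
  have p: "p \<in> Idx d n" and q: "q \<in> Idx d n"
    and lim: "((\<lambda>t. F (uvec d n q t) p) \<longlongrightarrow> 0) (at_right 0)"
    using e by (auto simp: Gdown_def)
  have neg: "(\<lambda>r. - ((\<lambda>_. 0)(q := t)) r) = (\<lambda>_. 0)(q := - t)" for t :: real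
    by auto
  have "filterlim (\<lambda>t::real. exp (- t)) (at_right 0) at_top"
    unfolding filterlim_at
    by (auto intro!: filterlim_compose[OF exp_at_bot] filterlim_uminus_at_bot_at_top)
  then have "((\<lambda>t. F (uvec d n q (exp (- t))) p) \<longlongrightarrow> 0) at_top"
    by (rule filterlim_compose[OF lim])
  moreover have "0 < F (uvec d n q (exp (- t))) p" for t
    using exp_log_conj[OF F p, of "(\<lambda>_. 0)(q := - t)"] exp_vec_coordinate_line[OF q, of "- t"] by simp
  ultimately have "filterlim (\<lambda>t. F (uvec d n q (exp (- t))) p) (at_right 0) at_top"
    unfolding filterlim_at by (auto simp: less_imp_neq[symmetric])
  then have "filterlim (\<lambda>t. ln (F (uvec d n q (exp (- t))) p)) at_bot at_top"
    by (rule filterlim_compose[OF ln_at_0])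
  then show ?thesis
    unfolding log_conj_def neg exp_vec_coordinate_line[OF q]
    by (simp add: filterlim_uminus_at_top[symmetric] filterlim_uminus_at_bot)
qed

section \<open>Eigenvectors on the unit spheres\<close>

text \<open>
  Dividing each block by its norm preserves eigenvectors, because a block scaling of the argument
  results in a block scaling of the image.
\<close>

lemma positive_eigenvector_normalised:
  assumes n: "\<forall>i\<in>{1..d}. 0 < n i" and N: "\<forall>i\<in>{1..d}. is_norm (n i) (N i)"
    and hom: "multi_homogeneous d n A F"
    and x: "x \<in> Kpp d n" and eig: "F x = lam \<otimes>\<^sub>b x"
  shows "\<exists>x\<in>Spp d n N. eigenvector d n F x"
proof -
  define \<alpha> where "\<alpha> i = (if i \<in> {1..d} then 1 / N i (\<lambda>j. x (i, j)) else 1)" for i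
  have vec: "(\<lambda>j. x (i, j)) \<in> Rvec (n i)" if "i \<in> {1..d}" for i
    using x by (auto simp: Rvec_def Kpp_def Idx_def)
  have Npos: "0 < N i (\<lambda>j. x (i, j))" if i: "i \<in> {1..d}" for i
  proof -
    have "0 < x (i, 1)" using x n i by (force simp: Kpp_def Idx_def)
    then have "(\<lambda>j. x (i, j)) \<noteq> (\<lambda>_. 0)" by (metis less_irrefl)
    then show ?thesis using N i vec[OF i] unfolding is_norm_def by (metis less_le)
  qed
  have \<alpha>: "0 < \<alpha> i" for i using Npos by (simp add: \<alpha>_def)
  define y where "y = \<alpha> \<otimes>\<^sub>b x"
  have yK: "y \<in> Kpp d n"
    using x \<alpha> by (auto simp: y_def block_scale_def Kpp_def)
  have "N i (\<lambda>j. y (i, j)) = 1" if i: "i \<in> {1..d}" for i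
  proof -
    have "N i (\<lambda>j. \<alpha> i * x (i, j)) = \<bar>\<alpha> i\<bar> * N i (\<lambda>j. x (i, j))"
      using bspec[OF N i] vec[OF i] unfolding is_norm_def by simp
    then show ?thesis using Npos[OF i] i by (simp add: y_def block_scale_def \<alpha>_def)
  qed
  then have "y \<in> Spp d n N" using yK by (simp add: Spp_def)
  moreover have "F y = (\<lambda>i. vec_powr d \<alpha> A i * lam i / \<alpha> i) \<otimes>\<^sub>b y"
  proof -
    have "F y = vec_powr d \<alpha> A \<otimes>\<^sub>b F x"
      using hom x Kpp_subset_Kplus \<alpha> unfolding multi_homogeneous_def y_def by blast
    then show ?thesis using \<alpha> by (auto simp: eig y_def block_scale_def less_imp_neq[symmetric])
  qed
  moreover have "\<exists>j\<in>{1..n i}. y (i, j) \<noteq> 0" if "i \<in> {1..d}" for i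
    using yK n that by (intro bexI[of _ 1]) (force simp: Kpp_def Idx_def)+
  ultimately show ?thesis
    unfolding eigenvector_def using yK Kpp_subset_Kplus by blast
qed

theorem theorem3p6:
  fixes d :: nat and n :: "nat \<Rightarrow> nat"
    and F :: "mvec \<Rightarrow> mvec" and A :: "nat \<Rightarrow> nat \<Rightarrow> real"
    and N :: "nat \<Rightarrow> (nat \<Rightarrow> real) \<Rightarrow> real"
    and G :: "((nat \<times> nat) \<times> (nat \<times> nat)) set"
  assumes "0 < d" and "\<forall>i\<in>{1..d}. 0 < n i"
    and "\<forall>i\<in>{1..d}. monotonic_norm (n i) (N i)"
    and "F \<in> Hclass d n A"
    and "\<exists>b::nat \<Rightarrow> real. (\<forall>i\<in>{1..d}. 0 < b i) \<and>
           (\<forall>k\<in>{1..d}. (\<Sum>i\<in>{1..d}. A i k * b i) = b k)"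
    and "G \<in> {Gup d n F, Gdown d n F}"
    and "\<forall>(\<nu>, l) \<in> Idx d n. \<forall>j \<in> (\<Pi> i\<in>{1..d}. {1..n i}).
           \<exists>i\<in>{1..d}. ((i, j i), (\<nu>, l)) \<in> G\<^sup>*"
  shows "\<exists>x \<in> Spp d n N. eigenvector d n F x"
proof -
  obtain b where b: "\<forall>i\<in>{1..d}. 0 < b i" "\<forall>k\<in>{1..d}. (\<Sum>i\<in>{1..d}. A i k * b i) = b k"
    using assms(5) by blast
  define f where "f = log_conj d n F"
  interpret multi_topical "Idx d n" "{1..d}" fst A b f
    unfolding f_def by (rule log_conj_multi_topical[OF assms(2,4) b])
  have reach: "\<exists>k\<in>{1..d}. (j k, q) \<in> G\<^sup>*"
    if j: "\<And>k. k \<in> {1..d} \<Longrightarrow> j k \<in> Idx d n \<and> fst (j k) = k" and q: "q \<in> Idx d n" for j q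
  proof -
    have "(\<lambda>k. snd (j k)) \<in> (\<Pi> i\<in>{1..d}. {1..n i})"
      using j by (fastforce simp: Idx_def)
    then have "\<exists>i\<in>{1..d}. ((i, snd (j i)), q) \<in> G\<^sup>*"
      using assms(7) q by (cases q) fast
    then show ?thesis using j by (metis prod.collapse)
  qed
  obtain y lam where y: "\<forall>p\<in>Idx d n. f y p = y p + lam (fst p)"
  proof (cases "G = Gup d n F")
    case True
    have "p \<in> Idx d n \<and> q \<in> Idx d n \<and> filterlim (\<lambda>t. f ((\<lambda>_. 0)(q := t)) p) at_top at_top"
      if "(p, q) \<in> G" for p q
      using that Gup_edge_log[of p q d n F] True unfolding f_def by (auto simp: Gup_def)
    from additive_eigenvector_exists[OF this reach] show ?thesis using that by blast
  next
    case False
    then have G: "G = Gdown d n F" using assms(6) by blast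
    interpret refl: multi_topical "Idx d n" "{1..d}" fst A b "\<lambda>x p. - f (\<lambda>q. - x q) p"
      by (rule reflection_multi_topical)
    have "p \<in> Idx d n \<and> q \<in> Idx d n \<and>
        filterlim (\<lambda>t. - f (\<lambda>r. - ((\<lambda>_. 0)(q := t)) r) p) at_top at_top"
      if "(p, q) \<in> G" for p q
      using that Gdown_edge_log[OF assms(4), of p q] G unfolding f_def by (auto simp: Gdown_def)
    from refl.additive_eigenvector_exists[OF this reach]
    obtain y lam where "\<forall>p\<in>Idx d n. - f (\<lambda>q. - y q) p = y p + lam (fst p)" by blast
    then have "\<forall>p\<in>Idx d n. f (\<lambda>q. - y q) p = - y p + - lam (fst p)" by force
    then show ?thesis using that[of "\<lambda>q. - y q" "\<lambda>k. - lam k"] by simp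
  qed
  have "F (exp_vec d n y) p = exp (lam (fst p)) * exp_vec d n y p" for p
  proof (cases "p \<in> Idx d n")
    case True
    then show ?thesis
      using y exp_log_conj[OF assms(4) True, of y]
      by (simp add: f_def exp_vec_def exp_add mult.commute)
  next
    case False
    then show ?thesis
      using Hclass_maps_Kpp[OF assms(4) exp_vec_in_Kpp[of d n y]]
      by (cases p) (auto simp: Kpp_def exp_vec_def)
  qed
  then have "F (exp_vec d n y) = (\<lambda>k. exp (lam k)) \<otimes>\<^sub>b exp_vec d n y"
    by (auto simp: block_scale_def)
  moreover have "multi_homogeneous d n A F" using assms(4) by (simp add: Hclass_def)
  moreover have "\<forall>i\<in>{1..d}. is_norm (n i) (N i)" using assms(3) by (simp add: monotonic_norm_def)
  ultimately show ?thesis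
    using positive_eigenvector_normalised[OF assms(2)] exp_vec_in_Kpp by blast
qed

end
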